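(* Every $3 \times 3 \times 3$ array $T = [\, t_{ijk} \,]_{1 \le i,j,k \le 3}$ with entries in $\mathbb{C}$ has rank at most $5$; that is, there exist an integer $0 \le n \le 5$ and vectors $\mathbf{a}^{(s)}, \mathbf{b}^{(s)}, \mathbf{c}^{(s)} \in \mathbb{C}^3$ for $1 \le s \le n$ such that $T = \sum_{s=1}^n \mathbf{a}^{(s)} \otimes \mathbf{b}^{(s)} \otimes \mathbf{c}^{(s)}$.
   Context: For vectors $\mathbf{a} \in \mathbb{C}^p$, $\mathbf{b} \in \mathbb{C}^q$, $\mathbf{c} \in \mathbb{C}^r$, the outer product $\mathbf{a} \otimes \mathbf{b} \otimes \mathbf{c}$ is the $p \times q \times r$ array whose $ijk$ entry is $a_i b_j c_k$. A simple tensor is an outer product of nonzero vectors. The rank of an array $X$ is the smallest non-negative integer $n$ such that $X$ is a sum of $n$ simple tensors (the zero array has rank $0$). *)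

theory Defs
  imports "HOL-Analysis.Analysis"
begin

text \<open>A \<open>p \<times> q \<times> r\<close> array over the complex numbers is an element of \<open>complex ^ 'r ^ 'q ^ 'p\<close>
  with \<open>CARD('p) = p\<close>, \<open>CARD('q) = q\<close>, \<open>CARD('r) = r\<close>; its \<open>ijk\<close> entry is \<open>X $ i $ j $ k\<close>.\<close>

definition outer3 :: "complex ^ 'p \<Rightarrow> complex ^ 'q \<Rightarrow> complex ^ 'r \<Rightarrow> complex ^ 'r ^ 'q ^ 'p" where
  "outer3 a b c = (\<chi> i j k. a $ i * b $ j * c $ k)"

definition simple_tensor :: "complex ^ 'r ^ 'q ^ 'p \<Rightarrow> bool" where
  "simple_tensor X \<longleftrightarrow> (\<exists>a b c. a \<noteq> 0 \<and> b \<noteq> 0 \<and> c \<noteq> 0 \<and> X = outer3 a b c)"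

definition sum_of_simple_tensors :: "nat \<Rightarrow> complex ^ 'r ^ 'q ^ 'p \<Rightarrow> bool" where
  "sum_of_simple_tensors n X \<longleftrightarrow>
     (\<exists>S :: nat \<Rightarrow> complex ^ 'r ^ 'q ^ 'p. (\<forall>s\<in>{1..n}. simple_tensor (S s)) \<and> X = (\<Sum>s=1..n. S s))"

definition tensor_rank :: "complex ^ 'r ^ 'q ^ 'p \<Rightarrow> nat" where
  "tensor_rank X = (LEAST n. sum_of_simple_tensors n X)"

text \<open>The set minimised over is never empty, so \<open>tensor_rank\<close> is a genuine minimum.\<close>

lemma ex_sum_of_simple_tensors:
  fixes X :: "complex ^ 'r::finite ^ 'q::finite ^ 'p::finite"
  shows "\<exists>n. sum_of_simple_tensors n X"
proof -
  define A where "A = {(i, j, k). X $ i $ j $ k \<noteq> 0}"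
  define F :: "'p \<times> 'q \<times> 'r \<Rightarrow> complex ^ 'r ^ 'q ^ 'p" where
    "F = (\<lambda>(i, j, k). outer3 (axis i 1) (axis j 1) (axis k (X $ i $ j $ k)))"
  have F_nth: "F t $ i $ j $ k = (if t = (i, j, k) then X $ i $ j $ k else 0)" for t i j k
    by (cases t) (auto simp: F_def outer3_def axis_def)
  have "(\<Sum>t\<in>A. F t) $ i $ j $ k = X $ i $ j $ k" for i j k
  proof -
    have "(\<Sum>t\<in>A. F t) $ i $ j $ k = (\<Sum>t\<in>A. if t = (i, j, k) then X $ i $ j $ k else 0)"
      by (simp add: F_nth)
    also have "\<dots> = X $ i $ j $ k"
      by (subst sum.delta) (auto simp: A_def)
    finally show ?thesis .
  qed
  then have X: "X = (\<Sum>t\<in>A. F t)"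
    by (simp add: vec_eq_iff)
  have simple: "simple_tensor (F t)" if "t \<in> A" for t
  proof -
    obtain i j k where t: "t = (i, j, k)"
      by (cases t)
    have "F t = outer3 (axis i 1) (axis j 1) (axis k (X $ i $ j $ k))"
      by (simp add: F_def t)
    moreover have "axis i (1::complex) \<noteq> 0" "axis j (1::complex) \<noteq> 0"
      "axis k (X $ i $ j $ k) \<noteq> 0"
      using that by (auto simp: A_def t axis_eq_0_iff)
    ultimately show ?thesis
      unfolding simple_tensor_def by blast
  qed
  obtain h where h: "bij_betw h {1..card A} A"
    using ex_bij_betw_nat_finite_1[of A] by auto
  have "X = (\<Sum>s=1..card A. F (h s))"
    unfolding X by (rule sum.reindex_bij_betw[OF h, symmetric])
  moreover have "\<forall>s\<in>{1..card A}. simple_tensor (F (h s))"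
    using bij_betw_apply[OF h] simple by blast
  ultimately have "sum_of_simple_tensors (card A) X"
    unfolding sum_of_simple_tensors_def by (intro exI[of _ "\<lambda>s. F (h s)"]) simp
  then show ?thesis ..
qed

end

theory Submission
  imports Defs "HOL-Computational_Algebra.Fundamental_Theorem_Algebra"
begin

text \<open>
  An array with slices \<open>A, B, C\<close> has rank at most \<open>n\<close> iff the slices lie in the span of \<open>n\<close>
  matrices of rank at most one. A pencil of \<open>3 \<times> 3\<close> matrices always needs at most four, and at
  most three if its determinant has three distinct zeros; a singular matrix needs at most two.
  Consider the cubic form \<open>det (z A + x B + y C)\<close>.

  If its restriction to some line has three distinct zeros, the pencil on that line (three matrices)
  and a singular matrix off the line (two matrices) cover the slices. Otherwise the discriminants of
  all restrictions vanish, and after a change of basis \<open>z ^ 2\<close> divides the form, so that the whole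
  pencil of \<open>B\<close> and \<open>C\<close> is singular. If \<open>B\<close> or \<open>C\<close> has rank one, or if they have a common left or
  right kernel vector, then some slice of the array, in one of the three directions, has rank at most
  one and the remaining two slices need at most four. In the remaining case \<open>B\<close> and \<open>C\<close> can be
  brought to an explicit sparse form, and for a suitable splitting \<open>B = E + E'\<close> into matrices of rank
  one the pencil of \<open>C + E\<close> and \<open>A + a E'\<close> has three distinct singular points for some scalar \<open>a\<close>.
\<close>

subsection \<open>Spans of matrices of rank at most one\<close>

definition mscale :: "complex \<Rightarrow> complex ^ 'q ^ 'p \<Rightarrow> complex ^ 'q ^ 'p" (infixr "\<cdot>" 75) where
  "c \<cdot> M = (\<chi> i. c *s M $ i)"

lemma mscale_nth [simp]: "(c \<cdot> M) $ i $ j = c * M $ i $ j"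
  by (simp add: mscale_def)

interpretation mats: vector_space "mscale :: complex \<Rightarrow> complex ^ 'q ^ 'p \<Rightarrow> complex ^ 'q ^ 'p"
  by unfold_locales (simp_all add: vec_eq_iff algebra_simps)

definition outer :: "complex ^ 'p \<Rightarrow> complex ^ 'q \<Rightarrow> complex ^ 'q ^ 'p" where
  "outer u v = (\<chi> i j. u $ i * v $ j)"

lemma outer_nth [simp]: "outer u v $ i $ j = u $ i * v $ j"
  by (simp add: outer_def)

text \<open>Bounding \<open>card G\<close> from above and admitting zero vectors keeps the notion
  monotone in \<open>n\<close> and stable under linear images, which may merge or annihilate
  generators.\<close>

definition simple_span :: "nat \<Rightarrow> (complex ^ 'q ^ 'p) set \<Rightarrow> bool" where
  "simple_span n S \<longleftrightarrow> (\<exists>G. finite G \<and> card G \<le> n \<and> (\<forall>E\<in>G. \<exists>u v. E = outer u v) \<and> S \<subseteq> mats.span G)"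

lemma simple_spanI:
  assumes "finite G" "card G \<le> n" "\<And>E. E \<in> G \<Longrightarrow> \<exists>u v. E = outer u v" "S \<subseteq> mats.span G"
  shows "simple_span n S"
  using assms unfolding simple_span_def by blast

lemma simple_span_mono: "simple_span m S \<Longrightarrow> m \<le> n \<Longrightarrow> simple_span n S"
  unfolding simple_span_def by (meson le_trans)

lemma simple_span_subset_span:
  assumes "simple_span n S" "S' \<subseteq> mats.span S"
  shows "simple_span n S'"
proof -
  obtain G where G: "finite G" "card G \<le> n" "\<forall>E\<in>G. \<exists>u v. E = outer u v" "S \<subseteq> mats.span G"
    using assms(1) unfolding simple_span_def by blast
  have "S' \<subseteq> mats.span G"
    using assms(2) mats.span_minimal[OF G(4) mats.subspace_span] by blast
  with G show ?thesis
    unfolding simple_span_def by blast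
qed

lemma simple_span_Un:
  assumes "simple_span m S" "simple_span n S'"
  shows "simple_span (m + n) (S \<union> S')"
proof -
  obtain G where G: "finite G" "card G \<le> m" "\<forall>E\<in>G. \<exists>u v. E = outer u v" "S \<subseteq> mats.span G"
    using assms(1) unfolding simple_span_def by blast
  obtain H where H: "finite H" "card H \<le> n" "\<forall>E\<in>H. \<exists>u v. E = outer u v" "S' \<subseteq> mats.span H"
    using assms(2) unfolding simple_span_def by blast
  show ?thesis
  proof (rule simple_spanI[of "G \<union> H"])
    show "card (G \<union> H) \<le> m + n"
      using card_Un_le[of G H] G(2) H(2) by linarith
    show "S \<union> S' \<subseteq> mats.span (G \<union> H)"
      using G(4) H(4) mats.span_mono[of G "G \<union> H"] mats.span_mono[of H "G \<union> H"] by blast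
  qed (use G H in auto)
qed

lemma simple_span_linear_image:
  fixes f :: "complex ^ 'q ^ 'p \<Rightarrow> complex ^ 's ^ 'r"
  assumes "simple_span n S" "module_hom mscale mscale f"
    and outer: "\<And>u v. \<exists>u' v'. f (outer u v) = outer u' v'"
  shows "simple_span n (f ` S)"
proof -
  interpret f: module_hom "mscale :: complex \<Rightarrow> complex ^ 'q ^ 'p \<Rightarrow> _" "mscale :: complex \<Rightarrow> complex ^ 's ^ 'r \<Rightarrow> _" f
    by fact
  obtain G where G: "finite G" "card G \<le> n" "\<forall>E\<in>G. \<exists>u v. E = outer u v" "S \<subseteq> mats.span G"
    using assms(1) unfolding simple_span_def by blast
  show ?thesis
  proof (rule simple_spanI[of "f ` G"])
    show "card (f ` G) \<le> n"
      using card_image_le[OF G(1), of f] G(2) by linarith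
    show "f ` S \<subseteq> mats.span (f ` G)"
      unfolding f.span_image using G(4) by blast
    show "\<exists>u v. E = outer u v" if "E \<in> f ` G" for E
      using that G(3) outer by (metis imageE)
  qed (use G in auto)
qed

lemma simple_span_transpose: "simple_span n S \<Longrightarrow> simple_span n (transpose ` S)"
proof (erule simple_span_linear_image)
  show "module_hom mscale mscale transpose"
    by unfold_locales (simp_all add: vec_eq_iff transpose_def algebra_simps)
  show "\<exists>u' v'. transpose (outer u v) = outer u' v'" for u v
    by (rule exI[of _ v], rule exI[of _ u]) (simp add: vec_eq_iff transpose_def mult.commute)
qed

lemma simple_span_mult:
  fixes P :: "complex ^ 'p ^ 'r" and Q :: "complex ^ 's ^ 'q" and S :: "(complex ^ 'q ^ 'p) set"
  shows "simple_span n S \<Longrightarrow> simple_span n ((\<lambda>M. P ** M ** Q) ` S)"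
proof (erule simple_span_linear_image)
  show "module_hom mscale mscale (\<lambda>M. P ** M ** Q)"
    by unfold_locales (simp_all add: vec_eq_iff matrix_matrix_mult_def algebra_simps
        sum_distrib_left sum_distrib_right sum.distrib)
  show "\<exists>u' v'. P ** outer u v ** Q = outer u' v'" for u v
    by (rule exI[of _ "P *v u"], rule exI[of _ "v v* Q"])
      (simp add: vec_eq_iff matrix_matrix_mult_def matrix_vector_mult_def vector_matrix_mult_def
        sum_distrib_left sum_distrib_right mult_ac)
qed

lemma simple_span_mult_iff:
  fixes P :: "complex ^ 'p ^ 'p" and Q :: "complex ^ 'q ^ 'q"
  assumes "invertible P" "invertible Q"
  shows "simple_span n ((\<lambda>M. P ** M ** Q) ` S) \<longleftrightarrow> simple_span n S"
proof
  obtain P' Q' where P': "P' ** P = mat 1" and Q': "Q ** Q' = mat 1"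
    using assms unfolding invertible_def by blast
  assume "simple_span n ((\<lambda>M. P ** M ** Q) ` S)"
  then have "simple_span n ((\<lambda>M. P' ** M ** Q') ` (\<lambda>M. P ** M ** Q) ` S)"
    by (rule simple_span_mult)
  moreover have "P' ** (P ** M ** Q) ** Q' = M" for M
    by (metis P' Q' matrix_mul_assoc matrix_mul_lid matrix_mul_rid)
  ultimately show "simple_span n S"
    by (simp add: image_image)
qed (rule simple_span_mult)

lemma in_span2:
  "M = a \<cdot> A + b \<cdot> B \<Longrightarrow> M \<in> mats.span {A, B}"
  by (auto intro: mats.span_add mats.span_scale mats.span_base)

lemma in_span3:
  "M = a \<cdot> A + b \<cdot> B + c \<cdot> C \<Longrightarrow> M \<in> mats.span {A, B, C}"
  by (auto intro: mats.span_add mats.span_scale mats.span_base)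

text \<open>The coefficient of the \<open>s\<close>-th generator in slice \<open>i\<close> becomes
  entry \<open>i\<close> of \<open>a s\<close>; the generator itself supplies \<open>b s\<close> and
  \<open>c s\<close>.\<close>

lemma simple_span_iff_tensor:
  fixes T :: "complex ^ 'r ^ 'q ^ 'p"
  shows "simple_span n (range (($) T)) \<longleftrightarrow> (\<exists>a b c. T = (\<Sum>s=1..n. outer3 (a s) (b s) (c s)))"
proof
  assume "simple_span n (range (($) T))"
  then obtain G where G: "finite G" "card G \<le> n" "\<forall>E\<in>G. \<exists>u v. E = outer u v" "range (($) T) \<subseteq> mats.span G"
    unfolding simple_span_def by blast
  obtain u v where uv: "E = outer (u E) (v E)" if "E \<in> G" for E
    using G(3) by metis
  have "\<exists>x. T $ i = (\<Sum>E\<in>G. x E \<cdot> E)" for i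
    using G(4) unfolding mats.span_finite[OF G(1)] by blast
  then obtain x where x: "T $ i = (\<Sum>E\<in>G. x i E \<cdot> E)" for i
    by metis
  obtain h where h: "bij_betw h {1..card G} G"
    using ex_bij_betw_nat_finite_1[OF G(1)] by auto
  \<comment> \<open>There may be fewer than \<open>n\<close> generators; zero coefficients fill the
    remaining summands.\<close>
  define a where "a s = (if s \<le> card G then \<chi> i. x i (h s) else 0)" for s
  have "T = (\<Sum>s=1..n. outer3 (a s) (u (h s)) (v (h s)))"
  proof -
    have "T $ i $ j $ k = (\<Sum>s=1..n. outer3 (a s) (u (h s)) (v (h s))) $ i $ j $ k" for i j k
    proof -
      have "T $ i $ j $ k = (\<Sum>E\<in>G. x i E * E $ j $ k)"
        by (simp add: x)
      also have "\<dots> = (\<Sum>E\<in>G. x i E * u E $ j * v E $ k)"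
        by (intro sum.cong refl) (metis mult.assoc outer_nth uv)
      also have "\<dots> = (\<Sum>s=1..card G. x i (h s) * u (h s) $ j * v (h s) $ k)"
        by (rule sum.reindex_bij_betw[OF h, symmetric])
      also have "\<dots> = (\<Sum>s=1..card G. a s $ i * u (h s) $ j * v (h s) $ k)"
        by (simp add: a_def)
      also have "\<dots> = (\<Sum>s=1..n. a s $ i * u (h s) $ j * v (h s) $ k)"
        using G(2) by (intro sum.mono_neutral_left) (auto simp: a_def)
      finally show ?thesis
        by (simp add: outer3_def)
    qed
    then show ?thesis
      by (simp add: vec_eq_iff)
  qed
  then show "\<exists>a b c. T = (\<Sum>s=1..n. outer3 (a s) (b s) (c s))"
    by (intro exI)
next
  assume "\<exists>a b c. T = (\<Sum>s=1..n. outer3 (a s) (b s) (c s))"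
  then obtain a b c where T: "T = (\<Sum>s=1..n. outer3 (a s) (b s) (c s))"
    by blast
  show "simple_span n (range (($) T))"
  proof (rule simple_spanI[of "(\<lambda>s. outer (b s) (c s)) ` {1..n}"])
    show "card ((\<lambda>s. outer (b s) (c s)) ` {1..n}) \<le> n"
      using card_image_le[of "{1..n}"] by simp
    have "T $ i = (\<Sum>s=1..n. (a s $ i) \<cdot> outer (b s) (c s))" for i
      by (simp add: T vec_eq_iff outer3_def mult.assoc)
    then show "range (($) T) \<subseteq> mats.span ((\<lambda>s. outer (b s) (c s)) ` {1..n})"
      by (simp add: image_subset_iff, intro allI mats.span_sum mats.span_scale mats.span_base) simp
  qed auto
qed

text \<open>Exchanging two factors of every outer product allows a bound to be proved on slices
  taken in another direction.\<close>

lemma simple_span_swap: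
  fixes T :: "complex ^ 'r ^ 'q ^ 'p"
  assumes "simple_span n (range (($) (\<chi> j i. T $ i $ j)))"
  shows "simple_span n (range (($) T))"
proof -
  obtain a b c where *: "(\<chi> j i. T $ i $ j) = (\<Sum>s=1..n. outer3 (a s) (b s) (c s))"
    using assms simple_span_iff_tensor by blast
  have "T = (\<Sum>s=1..n. outer3 (b s) (a s) (c s))"
  proof -
    have "T $ i $ j $ k = (\<Sum>s=1..n. outer3 (b s) (a s) (c s)) $ i $ j $ k" for i j k
    proof -
      have "T $ i $ j $ k = (\<chi> j i. T $ i $ j) $ j $ i $ k"
        by simp
      also have "\<dots> = (\<Sum>s=1..n. outer3 (b s) (a s) (c s)) $ i $ j $ k"
        unfolding * by (simp add: outer3_def mult_ac)
      finally show ?thesis .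
    qed
    then show ?thesis
      by (simp add: vec_eq_iff)
  qed
  then show ?thesis
    using simple_span_iff_tensor by blast
qed

subsection \<open>The adjugate of a \<open>3 \<times> 3\<close> matrix\<close>

text \<open>Indices live in the type \<open>3\<close>, whose arithmetic is modulo three; the cyclic indices
  account for the signs of the cofactors.\<close>

definition adj3 :: "complex ^ 3 ^ 3 \<Rightarrow> complex ^ 3 ^ 3" where
  "adj3 M = (\<chi> i j. M $ (j + 1) $ (i + 1) * M $ (j + 2) $ (i + 2) - M $ (j + 1) $ (i + 2) * M $ (j + 2) $ (i + 1))"

lemma three_arith: "(1::3) + 1 = 2" "(2::3) + 1 = 3" "(3::3) + 1 = 1"
  "(1::3) + 2 = 3" "(2::3) + 2 = 1" "(3::3) + 2 = 2"
  by simp_all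

lemma adj3_nth:
  "adj3 M $ 1 $ 1 = M $ 2 $ 2 * M $ 3 $ 3 - M $ 2 $ 3 * M $ 3 $ 2"
  "adj3 M $ 1 $ 2 = M $ 3 $ 2 * M $ 1 $ 3 - M $ 3 $ 3 * M $ 1 $ 2"
  "adj3 M $ 1 $ 3 = M $ 1 $ 2 * M $ 2 $ 3 - M $ 1 $ 3 * M $ 2 $ 2"
  "adj3 M $ 2 $ 1 = M $ 2 $ 3 * M $ 3 $ 1 - M $ 2 $ 1 * M $ 3 $ 3"
  "adj3 M $ 2 $ 2 = M $ 3 $ 3 * M $ 1 $ 1 - M $ 3 $ 1 * M $ 1 $ 3"
  "adj3 M $ 2 $ 3 = M $ 1 $ 3 * M $ 2 $ 1 - M $ 1 $ 1 * M $ 2 $ 3"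
  "adj3 M $ 3 $ 1 = M $ 2 $ 1 * M $ 3 $ 2 - M $ 2 $ 2 * M $ 3 $ 1"
  "adj3 M $ 3 $ 2 = M $ 3 $ 1 * M $ 1 $ 2 - M $ 3 $ 2 * M $ 1 $ 1"
  "adj3 M $ 3 $ 3 = M $ 1 $ 1 * M $ 2 $ 2 - M $ 1 $ 2 * M $ 2 $ 1"
  unfolding adj3_def by (simp_all only: vec_lambda_beta three_arith)

lemma mat3_eq_iff:
  fixes M :: "complex ^ 3 ^ 3"
  shows "M = N \<longleftrightarrow> M $ 1 $ 1 = N $ 1 $ 1 \<and> M $ 1 $ 2 = N $ 1 $ 2 \<and> M $ 1 $ 3 = N $ 1 $ 3
    \<and> M $ 2 $ 1 = N $ 2 $ 1 \<and> M $ 2 $ 2 = N $ 2 $ 2 \<and> M $ 2 $ 3 = N $ 2 $ 3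
    \<and> M $ 3 $ 1 = N $ 3 $ 1 \<and> M $ 3 $ 2 = N $ 3 $ 2 \<and> M $ 3 $ 3 = N $ 3 $ 3"
  by (simp add: vec_eq_iff forall_3)

text \<open>For singular \<open>M\<close> the right side is zero, so \<open>adj3 M\<close> has rank
  at most one. This is the source of the rank-one matrices used for pencils.\<close>

lemma adj3_adj3: "adj3 (adj3 M) = det M \<cdot> M"
  by (simp add: mat3_eq_iff adj3_nth det_3 algebra_simps)

lemma mult_adj3: "M ** adj3 M = det M \<cdot> mat 1"
  by (simp add: mat3_eq_iff adj3_nth det_3 matrix_matrix_mult_def sum_3 mat_def algebra_simps)

lemma adj3_mult: "adj3 M ** M = det M \<cdot> mat 1"
  by (simp add: mat3_eq_iff adj3_nth det_3 matrix_matrix_mult_def sum_3 mat_def algebra_simps)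

lemma adj3_outer: "adj3 (outer u v) = 0"
  by (simp add: mat3_eq_iff adj3_nth)

text \<open>The entries of \<open>adj3 M\<close> are, up to sign, all the \<open>2 x 2\<close>
  minors. Once they vanish, the row and the column through a nonzero pivot determine
  \<open>M\<close>.\<close>

lemma adj3_eq_0_imp_outer:
  assumes "adj3 M = 0"
  shows "\<exists>u v. M = outer u v"
proof (cases "M = 0")
  case True
  then have "M = outer 0 0"
    by (simp add: vec_eq_iff)
  then show ?thesis
    by blast
next
  case False
  then obtain i j where ij: "M $ i $ j \<noteq> 0"
    by (auto simp: vec_eq_iff)
  have "\<forall>i j k l. M $ i $ j * M $ k $ l = M $ k $ j * M $ i $ l"
    using assms by (simp add: forall_3 mat3_eq_iff adj3_nth algebra_simps)
  then have "M = outer (\<chi> k. M $ k $ j) (\<chi> l. M $ i $ l / M $ i $ j)"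
    using ij by (simp add: vec_eq_iff field_simps)
  then show ?thesis
    by blast
qed

section \<open>Bounds for a single matrix\<close>

lemma simple_span_1_outer: "simple_span 1 {outer u v}"
  by (rule simple_spanI[of "{outer u v}"]) (auto intro: mats.span_base)

lemma simple_span_1_adj3: "adj3 M = 0 \<Longrightarrow> simple_span 1 {M}"
  using adj3_eq_0_imp_outer simple_span_1_outer by blast

text \<open>Since \<open>w $ i\<close> is nonzero, column \<open>i\<close> is a combination of the
  other columns; distributing it over them leaves one outer product per remaining column.\<close>

lemma simple_span_kernel:
  fixes M :: "complex ^ 'q ^ 'p"
  assumes "M *v w = 0" "w $ i \<noteq> 0"
  shows "simple_span (CARD('q) - 1) {M}"
proof -
  define E where "E l = outer (column l M) (axis l 1 - (w $ l / w $ i) *s axis i 1)" for l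
  have "M $ a $ b = (\<Sum>l\<in>UNIV - {i}. E l) $ a $ b" for a b
  proof -
    have "(\<Sum>l\<in>UNIV. M $ a $ l * w $ l) = 0"
      using assms(1) by (simp add: vec_eq_iff matrix_vector_mult_def)
    then have s: "(\<Sum>l\<in>UNIV - {i}. M $ a $ l * w $ l) = - M $ a $ i * w $ i"
      by (subst (asm) sum.remove[of _ i]) (auto simp: algebra_simps add_eq_0_iff)
    have "(\<Sum>l\<in>UNIV - {i}. E l) $ a $ b =
        (\<Sum>l\<in>UNIV - {i}. M $ a $ l * axis l 1 $ b) - (\<Sum>l\<in>UNIV - {i}. M $ a $ l * w $ l) / w $ i * axis i 1 $ b"
      by (simp add: E_def column_def algebra_simps sum_subtractf sum_divide_distrib sum_distrib_left)
    also have "(\<Sum>l\<in>UNIV - {i}. M $ a $ l * axis l 1 $ b) = (if b = i then 0 else M $ a $ b)"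
      by (simp add: axis_def if_distrib sum.delta cong: if_cong)
    finally show ?thesis
      unfolding s using assms(2) by (simp add: axis_def)
  qed
  then have M: "M = (\<Sum>l\<in>UNIV - {i}. E l)"
    by (simp add: vec_eq_iff)
  show ?thesis
  proof (rule simple_spanI[of "E ` (UNIV - {i})"])
    show "card (E ` (UNIV - {i})) \<le> CARD('q) - 1"
      using card_image_le[of "UNIV - {i}" E] by simp
    show "{M} \<subseteq> mats.span (E ` (UNIV - {i}))"
      by (subst M) (simp, intro mats.span_sum mats.span_base imageI)
    show "\<exists>u v. F = outer u v" if "F \<in> E ` (UNIV - {i})" for F
      using that by (auto simp: E_def)
  qed auto
qed

lemma simple_span_2_singular:
  fixes M :: "complex ^ 3 ^ 3"
  assumes "det M = 0"
  shows "simple_span 2 {M}"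
proof (cases "adj3 M = 0")
  case True
  then show ?thesis
    using simple_span_1_adj3 simple_span_mono[of 1] by fastforce
next
  case False
  then obtain i j where "adj3 M $ i $ j \<noteq> 0"
    by (auto simp: vec_eq_iff)
  moreover have "M *v column j (adj3 M) = 0"
    using mult_adj3[of M] assms
    by (simp add: vec_eq_iff matrix_matrix_mult_def matrix_vector_mult_def column_def)
  ultimately show ?thesis
    using simple_span_kernel[of M "column j (adj3 M)" i] by (simp add: column_def)
qed

subsection \<open>Pencils of \<open>3 \<times> 3\<close> matrices\<close>

text \<open>The discriminant of the monic cubic
  \<open>X ^ 3 + a * X ^ 2 + b * X + c\<close>.\<close>

definition disc3 :: "complex \<Rightarrow> complex \<Rightarrow> complex \<Rightarrow> complex" where
  "disc3 a b c = a\<^sup>2 * b\<^sup>2 - 4 * b ^ 3 - 4 * a ^ 3 * c - 27 * c\<^sup>2 + 18 * a * b * c"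

lemma disc3_roots:
  "disc3 (- (r + s + t)) (r * s + s * t + t * r) (- (r * s * t)) = ((r - s) * (s - t) * (t - r))\<^sup>2"
  by (simp add: disc3_def power2_eq_square power3_eq_cube algebra_simps)

lemma quadratic_factor:
  fixes p q :: complex
  obtains s t where "p = - (s + t)" "q = s * t"
proof -
  define w where "w = csqrt (p\<^sup>2 - 4 * q)"
  have w: "w * w = p\<^sup>2 - 4 * q"
    by (metis w_def power2_csqrt power2_eq_square)
  have "(- p + w) / 2 * ((- p - w) / 2) = (p\<^sup>2 - w * w) / 4"
    by (simp add: field_simps power2_eq_square)
  then have "q = (- p + w) / 2 * ((- p - w) / 2)"
    unfolding w by simp
  moreover have "p = - ((- p + w) / 2 + (- p - w) / 2)"
    by (simp add: field_simps)
  ultimately show ?thesis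
    using that by blast
qed

lemma cubic_factor:
  fixes a b c :: complex
  obtains r s t where "a = - (r + s + t)" "b = r * s + s * t + t * r" "c = - (r * s * t)"
proof -
  have "\<not> constant (poly [:c, b, a, 1:])"
    by (simp add: constant_degree)
  then obtain r where "poly [:c, b, a, 1:] r = 0"
    using fundamental_theorem_of_algebra by blast
  then have c: "c = - (b * r + a * r\<^sup>2 + r ^ 3)"
    by (simp add: algebra_simps power2_eq_square power3_eq_cube add_eq_0_iff)
  obtain s t where "a + r = - (s + t)" "b + r * (a + r) = s * t"
    using quadratic_factor .
  then have a: "a = - (r + s + t)" and b: "b = s * t + r * (s + t)"
    by algebra+
  show ?thesis
    by (rule that[OF a]) (simp_all add: a b c power2_eq_square power3_eq_cube algebra_simps)
qed

section \<open>Invariants along a pencil\<close>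

text \<open>The terms of degree one in \<open>M\<close> or in \<open>A\<close> are directional
  derivatives of the determinant, hence traces against an adjugate (Jacobi's formula).\<close>

lemma det_pencil:
  "det (z \<cdot> A + M) = z ^ 3 * det A + z\<^sup>2 * trace (adj3 A ** M) + z * trace (adj3 M ** A) + det M"
  by (simp add: adj3_nth det_3 matrix_matrix_mult_def sum_3 trace_def power2_eq_square
      power3_eq_cube algebra_simps)

lemma trace_shift: "trace (t \<cdot> mat 1 + B :: complex ^ 3 ^ 3) = 3 * t + trace B"
  by (simp add: trace_def sum_3 mat_def)

lemma trace_adj3_shift: "trace (adj3 (t \<cdot> mat 1 + B)) = trace (adj3 B) + 2 * t * trace B + 3 * t\<^sup>2"
  by (simp add: trace_def sum_3 mat_def adj3_nth power2_eq_square algebra_simps)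

lemma det_shift: "det (t \<cdot> mat 1 + B :: complex ^ 3 ^ 3) = t ^ 3 + trace B * t\<^sup>2 + trace (adj3 B) * t + det B"
  by (simp add: trace_def sum_3 mat_def adj3_nth det_3 power2_eq_square power3_eq_cube algebra_simps)

lemma adj3_shift: "adj3 (t \<cdot> mat 1 + B) = adj3 B + t \<cdot> (trace B \<cdot> mat 1 - B) + t\<^sup>2 \<cdot> mat 1"
  by (simp add: mat3_eq_iff trace_def sum_3 mat_def adj3_nth power2_eq_square algebra_simps)

text \<open>The adjugates of \<open>t \<cdot> mat 1 + B\<close> at the three roots \<open>t\<close> have rank one. They depend
  quadratically on \<open>t\<close> with leading coefficients \<open>mat 1\<close> and \<open>trace B \<cdot> mat 1 - B\<close>, which
  divided differences recover.\<close>

lemma simple_span_3_distinct_roots: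
  fixes B :: "complex ^ 3 ^ 3"
  assumes "r \<noteq> s" "s \<noteq> t" "t \<noteq> r"
    and "det (r \<cdot> mat 1 + B) = 0" "det (s \<cdot> mat 1 + B) = 0" "det (t \<cdot> mat 1 + B) = 0"
  shows "simple_span 3 {mat 1, B}"
proof -
  define N where "N x = adj3 (x \<cdot> mat 1 + B)" for x
  have simple: "\<exists>u v. N x = outer u v" if "det (x \<cdot> mat 1 + B) = 0" for x
    using adj3_adj3[of "x \<cdot> mat 1 + B"] that
    by (intro adj3_eq_0_imp_outer) (simp add: N_def)
  have "simple_span 3 {N r, N s, N t}"
    using simple assms(4-) card_insert_le_m1[of 3 "{N s, N t}" "N r"] card_insert_le_m1[of 2 "{N t}" "N s"]
    by (intro simple_spanI[of "{N r, N s, N t}"]) (auto intro: mats.span_base)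
  moreover have "{mat 1, B} \<subseteq> mats.span {N r, N s, N t}"
  proof -
    let ?S = "mats.span {N r, N s, N t}"
    have NS: "N r \<in> ?S" "N s \<in> ?S" "N t \<in> ?S"
      by (auto intro: mats.span_base)
    have D: "inverse (x - y) \<cdot> (N x - N y) = (trace B \<cdot> mat 1 - B) + (x + y) \<cdot> mat 1" if "x \<noteq> y" for x y
    proof -
      have "N x - N y = (x - y) \<cdot> ((trace B \<cdot> mat 1 - B) + (x + y) \<cdot> mat 1)"
        unfolding N_def adj3_shift by (simp add: vec_eq_iff algebra_simps power2_eq_square)
      then show ?thesis
        using that by simp
    qed
    have "inverse (r - s) \<cdot> (N r - N s) \<in> ?S" "inverse (r - t) \<cdot> (N r - N t) \<in> ?S"
      using NS by (auto intro: mats.span_scale mats.span_diff)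
    then have *: "(trace B \<cdot> mat 1 - B) + (r + s) \<cdot> mat 1 \<in> ?S" "(trace B \<cdot> mat 1 - B) + (r + t) \<cdot> mat 1 \<in> ?S"
      unfolding D[OF assms(1)] D[OF assms(3)[symmetric]] .
    have "((trace B \<cdot> mat 1 - B) + (r + s) \<cdot> mat 1) - ((trace B \<cdot> mat 1 - B) + (r + t) \<cdot> mat 1) = (s - t) \<cdot> (mat 1 :: complex ^ 3 ^ 3)"
      by (simp add: vec_eq_iff algebra_simps)
    then have "(s - t) \<cdot> mat 1 \<in> ?S"
      using mats.span_diff[OF *] by simp
    then have "inverse (s - t) \<cdot> (s - t) \<cdot> mat 1 \<in> ?S"
      by (rule mats.span_scale)
    then have 1: "mat 1 \<in> ?S"
      using assms(2) by simp
    have "B = (trace B + (r + s)) \<cdot> mat 1 - ((trace B \<cdot> mat 1 - B) + (r + s) \<cdot> mat 1)"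
      by (simp add: vec_eq_iff algebra_simps)
    then have "B \<in> ?S"
      using mats.span_diff[OF mats.span_scale[OF 1] *(1)] by metis
    with 1 show ?thesis
      by simp
  qed
  ultimately show ?thesis
    by (rule simple_span_subset_span)
qed

text \<open>By \<open>det_shift\<close> and Vieta, \<open>r\<close>, \<open>s\<close>,
  \<open>t\<close> are the zeros of \<open>det (x \<cdot> mat 1 + B)\<close>, and the discriminant
  separates them.\<close>

lemma simple_span_3_disc3:
  assumes "disc3 (trace B) (trace (adj3 B)) (det B) \<noteq> 0"
  shows "simple_span 3 {mat 1, B}"
proof -
  obtain r s t where rst: "trace B = - (r + s + t)" "trace (adj3 B) = r * s + s * t + t * r" "det B = - (r * s * t)"
    using cubic_factor .
  have "r \<noteq> s" "s \<noteq> t" "t \<noteq> r"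
    using assms unfolding rst disc3_roots by auto
  then show ?thesis
    by (rule simple_span_3_distinct_roots)
      (simp_all only: det_shift rst, simp_all add: power2_eq_square power3_eq_cube algebra_simps)
qed

lemma simple_span_CARD: "simple_span (CARD('p::finite)) {M :: complex ^ 'q ^ 'p}"
proof (rule simple_spanI[of "range (\<lambda>i. outer (axis i 1) (M $ i))"])
  show "card (range (\<lambda>i. outer (axis i 1) (M $ i))) \<le> CARD('p)"
    by (rule card_image_le) simp
  have "M = (\<Sum>i\<in>UNIV. outer (axis i 1) (M $ i))"
    by (simp add: vec_eq_iff axis_def if_distrib[of "\<lambda>x. x * _"] cong: if_cong)
  moreover have "(\<Sum>i\<in>UNIV. outer (axis i 1) (M $ i)) \<in> mats.span (range (\<lambda>i. outer (axis i 1) (M $ i)))"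
    by (intro mats.span_sum mats.span_base rangeI)
  ultimately show "{M} \<subseteq> mats.span (range (\<lambda>i. outer (axis i 1) (M $ i)))"
    by simp
qed auto

text \<open>Multiplication by an inverse reduces families with a nonsingular member to families
  containing \<open>mat 1\<close>.\<close>

lemma simple_span_insert_mat_1:
  fixes N N' :: "complex ^ 'p ^ 'p"
  assumes "N' ** N = mat 1"
  shows "simple_span n (insert N S) \<longleftrightarrow> simple_span n (insert (mat 1) ((**) N' ` S))"
proof -
  have "invertible N'"
    using assms invertible_right_inverse by blast
  then have "simple_span n ((\<lambda>M. N' ** M ** mat 1) ` insert N S) \<longleftrightarrow> simple_span n (insert N S)"
    by (intro simple_span_mult_iff) (auto simp: invertible_def)
  then show ?thesis
    by (simp add: assms)
qed

text \<open>Here \<open>det (t \<cdot> mat 1 + B)\<close> is \<open>t ^ 3\<close>. A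
  \<open>B\<close> of rank at most one costs \<open>3 + 1\<close>; otherwise a rank-one perturbation
  splits the triple zero, and undoing it costs the fourth matrix.\<close>

lemma simple_span_4_nilpotent:
  assumes "trace B = 0" "trace (adj3 B) = 0" "det B = 0"
  shows "simple_span 4 {mat 1, B}"
proof (cases "adj3 B = 0")
  case True
  have "simple_span (3 + 1) ({mat 1} \<union> {B})"
    using simple_span_Un[OF _ simple_span_1_adj3[OF True], of 3 "{mat 1}"] simple_span_CARD[of "mat 1 :: complex ^ 3 ^ 3"]
    by simp
  then show ?thesis
    by (simp add: insert_commute)
next
  case False
  then obtain i j where ij: "adj3 B $ i $ j \<noteq> 0"
    by (auto simp: vec_eq_iff)
  \<comment> \<open>The rank-one perturbation \<open>B + s \<cdot> E\<close> has a squarefree characteristic polynomial for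
    suitable \<open>s\<close>: its discriminant is \<open>- 27 * (s * adj3 B $ i $ j)\<^sup>2 + O(s ^ 3)\<close>.\<close>
  define E :: "complex ^ 3 ^ 3" where "E = outer (axis j 1) (axis i 1)"
  define d :: complex where "d = (if i = j then 1 else 0)"
  have E: "trace (B + s \<cdot> E) = s * d" "trace (adj3 (B + s \<cdot> E)) = s * - B $ i $ j"
    "det (B + s \<cdot> E) = s * adj3 B $ i $ j" for s
  proof -
    \<comment> \<open>Quantifying over all positions reduces each invariant to nine explicit
      cases.\<close>
    have "\<forall>i j. trace (B + s \<cdot> outer (axis j 1) (axis i 1)) = trace B + s * (if i = j then 1 else 0)"
      by (simp add: forall_3 trace_def sum_3 axis_def)
    then show "trace (B + s \<cdot> E) = s * d"
      unfolding E_def d_def assms by simp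
    have "\<forall>i j. trace (adj3 (B + s \<cdot> outer (axis j 1) (axis i 1))) =
        trace (adj3 B) + s * ((if i = j then trace B else 0) - B $ i $ j)"
      by (simp add: forall_3 trace_def sum_3 axis_def adj3_nth algebra_simps)
    then show "trace (adj3 (B + s \<cdot> E)) = s * - B $ i $ j"
      unfolding E_def d_def assms by simp
    have "\<forall>i j. det (B + s \<cdot> outer (axis j 1) (axis i 1)) = det B + s * adj3 B $ i $ j"
      by (simp add: forall_3 det_3 axis_def adj3_nth algebra_simps)
    then show "det (B + s \<cdot> E) = s * adj3 B $ i $ j"
      unfolding E_def assms by simp
  qed
  have "\<exists>s. disc3 (s * d) (s * - B $ i $ j) (s * adj3 B $ i $ j) \<noteq> 0"
  proof (rule ccontr)
    define x where "x = 4 * (B $ i $ j) ^ 3 - 18 * d * B $ i $ j * adj3 B $ i $ j"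
    define y where "y = d\<^sup>2 * (B $ i $ j)\<^sup>2 - 4 * d ^ 3 * adj3 B $ i $ j"
    define w where "w = (adj3 B $ i $ j)\<^sup>2"
    have g: "disc3 (s * d) (s * - B $ i $ j) (s * adj3 B $ i $ j) = s\<^sup>2 * (s\<^sup>2 * y + s * x - 27 * w)" for s
      by (simp add: disc3_def x_def y_def w_def power2_eq_square power3_eq_cube algebra_simps)
    assume "\<not> ?thesis"
    then have *: "s\<^sup>2 * (s\<^sup>2 * y + s * x - 27 * w) = 0" for s
      unfolding g by blast
    \<comment> \<open>The samples \<open>1\<close>, \<open>-1\<close>, \<open>2\<close> give three
      linear equations in \<open>x\<close>, \<open>y\<close>, \<open>w\<close> with only the zero
      solution.\<close>
    have "y + x - 27 * w = 0" "y - x - 27 * w = 0" "16 * y + 8 * x = 108 * w"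
      using *[of 1] *[of "-1"] *[of 2] by simp_all
    then have "w = 0"
      by algebra
    then show False
      using ij by (simp add: w_def)
  qed
  then obtain s where "disc3 (s * d) (s * - B $ i $ j) (s * adj3 B $ i $ j) \<noteq> 0"
    by blast
  then have "simple_span 3 {mat 1, B + s \<cdot> E}"
    by (intro simple_span_3_disc3) (simp only: E not_False_eq_True)
  then have "simple_span (3 + 1) ({mat 1, B + s \<cdot> E} \<union> {E})"
    using simple_span_1_outer unfolding E_def by (rule simple_span_Un)
  then have "simple_span 4 {mat 1, B + s \<cdot> E, E}"
    by (simp add: insert_commute)
  then show ?thesis
  proof (rule simple_span_subset_span)
    have "B = 0 \<cdot> mat 1 + 1 \<cdot> (B + s \<cdot> E) + (- s) \<cdot> E" "mat 1 = 1 \<cdot> mat 1 + 0 \<cdot> (B + s \<cdot> E) + 0 \<cdot> E"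
      by (simp_all add: vec_eq_iff)
    then show "{mat 1, B} \<subseteq> mats.span {mat 1, B + s \<cdot> E, E}"
      using in_span3 by blast
  qed
qed

text \<open>Two distinct zeros of the determinant give two singular matrices spanning the pencil, at
  cost \<open>2 + 2\<close>; a triple zero is shifted to the nilpotent case.\<close>

lemma simple_span_4_mat_1: "simple_span 4 {mat 1, B :: complex ^ 3 ^ 3}"
proof -
  obtain r s t where rst: "trace B = - (r + s + t)" "trace (adj3 B) = r * s + s * t + t * r" "det B = - (r * s * t)"
    using cubic_factor .
  have det: "det (x \<cdot> mat 1 + B) = (x - r) * (x - s) * (x - t)" for x
    unfolding det_shift rst by (simp add: power2_eq_square power3_eq_cube algebra_simps)
  have two: "simple_span 4 {mat 1, B}" if "x \<noteq> y" "det (x \<cdot> mat 1 + B) = 0" "det (y \<cdot> mat 1 + B) = 0" for x y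
  proof -
    have "simple_span (2 + 2) ({x \<cdot> mat 1 + B} \<union> {y \<cdot> mat 1 + B})"
      using that by (intro simple_span_Un simple_span_2_singular)
    then have "simple_span 4 {x \<cdot> mat 1 + B, y \<cdot> mat 1 + B}"
      by (simp add: insert_commute)
    then show ?thesis
    proof (rule simple_span_subset_span)
      define k where "k = inverse (x - y)"
      have k: "M = k \<cdot> (x - y) \<cdot> M" for M :: "complex ^ 3 ^ 3"
        using that(1) by (simp add: k_def)
      have "k \<cdot> (x - y) \<cdot> mat 1 = k \<cdot> (x \<cdot> mat 1 + B) + (- k) \<cdot> (y \<cdot> mat 1 + B)"
        by (simp add: vec_eq_iff algebra_simps)
      then have "mat 1 = k \<cdot> (x \<cdot> mat 1 + B) + (- k) \<cdot> (y \<cdot> mat 1 + B)"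
        by (simp only: k[symmetric])
      moreover have "k \<cdot> (x - y) \<cdot> B = (- (k * y)) \<cdot> (x \<cdot> mat 1 + B) + (k * x) \<cdot> (y \<cdot> mat 1 + B)"
        by (simp add: vec_eq_iff algebra_simps)
      then have "B = (- (k * y)) \<cdot> (x \<cdot> mat 1 + B) + (k * x) \<cdot> (y \<cdot> mat 1 + B)"
        by (simp only: k[symmetric])
      ultimately show "{mat 1, B} \<subseteq> mats.span {x \<cdot> mat 1 + B, y \<cdot> mat 1 + B}"
        using in_span2 by blast
    qed
  qed
  show ?thesis
  proof (cases "r = s \<and> s = t")
    case True
    have "simple_span 4 {mat 1, r \<cdot> mat 1 + B}"
      using True by (intro simple_span_4_nilpotent)
        (simp_all only: trace_shift trace_adj3_shift det_shift rst,
          simp_all add: power2_eq_square power3_eq_cube algebra_simps)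
    then show ?thesis
    proof (rule simple_span_subset_span)
      have "B = (- r) \<cdot> mat 1 + 1 \<cdot> (r \<cdot> mat 1 + B)" "mat 1 = 1 \<cdot> mat 1 + 0 \<cdot> (r \<cdot> mat 1 + B)"
        by (simp_all add: vec_eq_iff)
      then show "{mat 1, B} \<subseteq> mats.span {mat 1, r \<cdot> mat 1 + B}"
        using in_span2 by blast
    qed
  next
    case False
    then show ?thesis
      using two[of r s] two[of s t] by (auto simp: det)
  qed
qed

lemma simple_span_4_pair: "simple_span 4 {A, B :: complex ^ 3 ^ 3}"
proof -
  have inv: "simple_span 4 {A, B}" if "det A \<noteq> 0" for A B :: "complex ^ 3 ^ 3"
  proof -
    obtain N where "N ** A = mat 1"
      using \<open>det A \<noteq> 0\<close> invertible_det_nz[of A] invertible_left_inverse[of A] by blast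
    then show ?thesis
      using simple_span_insert_mat_1[of N A 4 "{B}"] simple_span_4_mat_1 by simp
  qed
  show ?thesis
  proof (cases "det A = 0 \<and> det B = 0")
    case True
    then have "simple_span (2 + 2) ({A} \<union> {B})"
      by (intro simple_span_Un simple_span_2_singular) auto
    then show ?thesis
      by (simp add: insert_commute)
  next
    case False
    then show ?thesis
      using inv[of A B] inv[of B A] by (auto simp: insert_commute)
  qed
qed

subsection \<open>Degenerate triples of matrices\<close>

lemma simple_span_replace:
  assumes "simple_span n {x \<cdot> A + y \<cdot> B + z \<cdot> C, B, C}" "x \<noteq> 0"
  shows "simple_span n {A, B, C}"
  using assms(1)
proof (rule simple_span_subset_span)
  let ?M = "x \<cdot> A + y \<cdot> B + z \<cdot> C"
  have "A = (1 / x) \<cdot> ?M + (- y / x) \<cdot> B + (- z / x) \<cdot> C"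
    using assms(2) by (simp add: vec_eq_iff field_simps)
  then have "A \<in> mats.span {?M, B, C}"
    by (rule in_span3)
  then show "{A, B, C} \<subseteq> mats.span {?M, B, C}"
    by (simp add: mats.span_base)
qed

lemma simple_span_5_singular_outer:
  assumes "adj3 (x \<cdot> A + y \<cdot> B + z \<cdot> C) = 0" "x \<noteq> 0"
  shows "simple_span 5 {A, B, C}"
proof (rule simple_span_replace[OF _ assms(2)])
  have "simple_span (1 + 4) ({x \<cdot> A + y \<cdot> B + z \<cdot> C} \<union> {B, C})"
    using assms by (intro simple_span_Un simple_span_1_adj3 simple_span_4_pair)
  then show "simple_span 5 {x \<cdot> A + y \<cdot> B + z \<cdot> C, B, C}"
    by (simp add: insert_commute)
qed

lemma range_vector_3: "range (($) (vector [A, B, C] :: 'a::zero ^ 3)) = {A, B, C}"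
  by (auto simp: UNIV_3 image_insert)

text \<open>Slicing the array by rows instead makes slice \<open>j\<close> vanish, so only a pair of
  matrices is left.\<close>

lemma simple_span_4_zero_row:
  fixes A B C :: "complex ^ 3 ^ 3"
  assumes "A $ j = 0" "B $ j = 0" "C $ j = 0"
  shows "simple_span 4 {A, B, C}"
proof -
  define T :: "complex ^ 3 ^ 3 ^ 3" where "T = vector [A, B, C]"
  define T' :: "complex ^ 3 ^ 3 ^ 3" where "T' = (\<chi> j i. T $ i $ j)"
  have 0: "T' $ j = 0"
    using assms by (simp add: T'_def T_def vec_eq_iff forall_3)
  have "\<exists>X Y. range (($) T') \<subseteq> mats.span {X, Y}"
  proof -
    have "\<exists>X Y. {T' $ 1, T' $ 2, T' $ 3} \<subseteq> {0, X, Y}"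
      using exhaust_3[of j] 0 by auto
    then obtain X Y where "range (($) T') \<subseteq> {0, X, Y}"
      by (auto simp: UNIV_3)
    moreover have "{0, X, Y} \<subseteq> mats.span {X, Y}"
      by (simp add: mats.span_base mats.span_zero)
    ultimately show ?thesis
      by blast
  qed
  then have "simple_span 4 (range (($) T'))"
    using simple_span_4_pair simple_span_subset_span by metis
  then have "simple_span 4 (range (($) T))"
    unfolding T'_def by (rule simple_span_swap)
  then show ?thesis
    unfolding T_def range_vector_3 .
qed

text \<open>Row \<open>j\<close> of \<open>A\<close> is one outer product; after removing it, row
  \<open>j\<close> is zero in all three matrices.\<close>

lemma simple_span_5_zero_row:
  fixes A B C :: "complex ^ 3 ^ 3"
  assumes "B $ j = 0" "C $ j = 0"
  shows "simple_span 5 {A, B, C}"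
proof -
  define E where "E = outer (axis j 1) (A $ j)"
  have "simple_span (1 + 4) ({E} \<union> {A - E, B, C})"
    unfolding E_def using assms
    by (intro simple_span_Un simple_span_1_outer simple_span_4_zero_row[of _ j]) (auto simp: vec_eq_iff axis_def)
  then have "simple_span 5 {E, A - E, B, C}"
    by (simp add: insert_commute)
  then show ?thesis
  proof (rule simple_span_subset_span)
    have "E + (A - E) \<in> mats.span {E, A - E, B, C}"
      by (intro mats.span_add mats.span_base) auto
    then show "{A, B, C} \<subseteq> mats.span {E, A - E, B, C}"
      by (simp add: mats.span_base)
  qed
qed

text \<open>Taking \<open>q\<close> as row \<open>j\<close> of an invertible \<open>P\<close> makes
  row \<open>j\<close> of \<open>P ** B\<close> and of \<open>P ** C\<close> zero.\<close>

lemma simple_span_5_left_kernel: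
  fixes A B C :: "complex ^ 3 ^ 3"
  assumes "q \<noteq> 0" "q v* B = 0" "q v* C = 0"
  shows "simple_span 5 {A, B, C}"
proof -
  obtain j where j: "q $ j \<noteq> 0"
    using assms(1) by (auto simp: vec_eq_iff)
  define P where "P = (\<chi> i. if i = j then q else axis i 1)"
  have "\<forall>j. det (\<chi> i. if i = j then q else axis i 1) = q $ j"
    by (simp add: forall_3 det_3 axis_def)
  then have "det P \<noteq> 0"
    using j by (simp add: P_def)
  then have "invertible P"
    by (simp add: invertible_det_nz)
  moreover have "(P ** M) $ j = q v* M" for M :: "complex ^ 3 ^ 3"
    by (simp add: P_def vec_eq_iff matrix_matrix_mult_def vector_matrix_mult_def mult.commute)
  then have "simple_span 5 {P ** A, P ** B, P ** C}"
    using assms by (intro simple_span_5_zero_row[of _ j]) auto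
  ultimately show ?thesis
    using simple_span_mult_iff[of P "mat 1" 5 "{A, B, C}"] by (simp add: invertible_def)
qed

lemma simple_span_5_right_kernel:
  fixes A B C :: "complex ^ 3 ^ 3"
  assumes "p \<noteq> 0" "B *v p = 0" "C *v p = 0"
  shows "simple_span 5 {A, B, C}"
proof -
  have "simple_span 5 {transpose A, transpose B, transpose C}"
    using assms by (intro simple_span_5_left_kernel[of p]) simp_all
  then show ?thesis
    using simple_span_transpose[of 5 "{transpose A, transpose B, transpose C}"] by simp
qed

section \<open>Kernel vectors, sparse forms and singular points\<close>

text \<open>As a function of \<open>e\<close> the determinant is the pairing with the cross product
  of \<open>s\<close> and \<open>q\<close>; if it vanished on the three axes, \<open>s\<close> would
  be a multiple of \<open>q\<close>.\<close>

lemma det_rows_completion: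
  fixes q s :: "complex ^ 3"
  assumes "q \<noteq> 0" "\<nexists>c. s = c *s q"
  obtains e where "det (vector [e, s, q] :: complex ^ 3 ^ 3) \<noteq> 0"
proof (rule ccontr)
  assume "\<not> thesis"
  then have "det (vector [e, s, q] :: complex ^ 3 ^ 3) = 0" for e
    using that by blast
  from this[of "axis 1 1"] this[of "axis 2 1"] this[of "axis 3 1"]
  have "\<forall>i k. s $ i * q $ k = s $ k * q $ i"
    by (simp add: det_3 axis_def forall_3 mult.commute)
  moreover obtain i where "q $ i \<noteq> 0"
    using assms(1) by (auto simp: vec_eq_iff)
  ultimately have "s = (s $ i / q $ i) *s q"
    by (simp add: vec_eq_iff field_simps)
  with assms(2) show False
    by blast
qed

text \<open>Both products of a singular matrix with its adjugate vanish, so nonzero columns and rows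
  of the adjugate are kernel vectors.\<close>

lemma kernel_vectors:
  assumes "det B = 0" "adj3 B \<noteq> 0"
  obtains p q where "p \<noteq> 0" "B *v p = 0" "q \<noteq> 0" "q v* B = 0"
proof -
  obtain i j where ij: "adj3 B $ i $ j \<noteq> 0"
    using assms(2) by (auto simp: vec_eq_iff)
  have "B ** adj3 B = 0" "adj3 B ** B = 0"
    using assms(1) by (simp_all add: mult_adj3 adj3_mult)
  then have "B *v column j (adj3 B) = 0" "adj3 B $ i v* B = 0"
    by (simp_all add: vec_eq_iff matrix_matrix_mult_def matrix_vector_mult_def vector_matrix_mult_def
        column_def mult.commute)
  moreover have "column j (adj3 B) \<noteq> 0" "adj3 B $ i \<noteq> 0"
    using ij by (auto simp: vec_eq_iff column_def)
  ultimately show ?thesis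
    using that by blast
qed

text \<open>\<open>N\<close> is the singular point at infinity. Moving the nonsingular
  \<open>K\<close> to \<open>mat 1\<close> and using the parameter \<open>1 / (y - y0)\<close> turns
  the three points into \<open>0\<close>, \<open>1 / (y1 - y0)\<close> and
  \<open>1 / (y2 - y0)\<close>.\<close>

lemma simple_span_3_singular_points:
  fixes M N :: "complex ^ 3 ^ 3"
  assumes "det N = 0" "det (M + y1 \<cdot> N) = 0" "det (M + y2 \<cdot> N) = 0" "y1 \<noteq> y2"
    and nz: "det (M + y0 \<cdot> N) \<noteq> 0"
  shows "simple_span 3 {M, N}"
proof -
  define K where "K = M + y0 \<cdot> N"
  obtain K' where K': "K' ** K = mat 1"
    using nz invertible_det_nz[of K] invertible_left_inverse[of K] unfolding K_def by blast
  have sing: "det (t \<cdot> mat 1 + K' ** N) = 0" if "det (t \<cdot> K + N) = 0" for t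
  proof -
    have "K' ** (t \<cdot> K + N) = t \<cdot> (K' ** K) + K' ** N"
      by (simp add: mat3_eq_iff matrix_matrix_mult_def sum_3 algebra_simps)
    then show ?thesis
      using that by (metis K' det_mul mult_zero_right)
  qed
  have y: "y1 \<noteq> y0" "y2 \<noteq> y0"
    using assms by auto
  have *: "det (inverse (y - y0) \<cdot> K + N) = 0" if "det (M + y \<cdot> N) = 0" "y \<noteq> y0" for y
  proof -
    have "inverse (y - y0) \<cdot> K + N = inverse (y - y0) \<cdot> (M + y0 \<cdot> N + (y - y0) \<cdot> N)"
      using that(2) by (simp add: K_def mats.scale_right_distrib)
    also have "M + y0 \<cdot> N + (y - y0) \<cdot> N = M + y \<cdot> N"
      by (simp add: vec_eq_iff algebra_simps)
    finally have "inverse (y - y0) \<cdot> K + N = (inverse (y - y0) \<cdot> mat 1) ** (M + y \<cdot> N)"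
      by (simp add: mat3_eq_iff matrix_matrix_mult_def mat_def sum_3)
    then show ?thesis
      using that(1) by (simp add: det_mul)
  qed
  have "simple_span 3 {mat 1, K' ** N}"
  proof (rule simple_span_3_distinct_roots)
    show "det (0 \<cdot> mat 1 + K' ** N) = 0"
      by (rule sing) (simp add: assms)
    show "det (inverse (y1 - y0) \<cdot> mat 1 + K' ** N) = 0" "det (inverse (y2 - y0) \<cdot> mat 1 + K' ** N) = 0"
      by (rule sing, rule *, fact+)+
  qed (use assms(4) y in auto)
  then have "simple_span 3 {K, N}"
    using simple_span_insert_mat_1[OF K', of 3 "{N}"] by simp
  then show ?thesis
  proof (rule simple_span_subset_span)
    have "M = 1 \<cdot> K + (- y0) \<cdot> N" "N = 0 \<cdot> K + 1 \<cdot> N"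
      by (simp_all add: K_def)
    then show "{M, N} \<subseteq> mats.span {K, N}"
      using in_span2 by blast
  qed
qed

text \<open>The support is the first row together with the third column: five positions, hence five
  matrix units.\<close>

lemma simple_span_5_cross:
  fixes S :: "(complex ^ 3 ^ 3) set"
  assumes "\<And>M. M \<in> S \<Longrightarrow> M $ 2 $ 1 = 0 \<and> M $ 2 $ 2 = 0 \<and> M $ 3 $ 1 = 0 \<and> M $ 3 $ 2 = 0"
  shows "simple_span 5 S"
proof -
  define E :: "3 \<Rightarrow> 3 \<Rightarrow> complex ^ 3 ^ 3" where "E i j = outer (axis i 1) (axis j 1)" for i j
  let ?G = "{E 1 1, E 1 2, E 1 3, E 2 3, E 3 3}"
  have "card ?G \<le> 5"
    using card_length[of "[E 1 1, E 1 2, E 1 3, E 2 3, E 3 3]"] by simp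
  moreover have "M \<in> mats.span ?G" if "M \<in> S" for M
  proof -
    have "M = M $ 1 $ 1 \<cdot> E 1 1 + (M $ 1 $ 2 \<cdot> E 1 2 + (M $ 1 $ 3 \<cdot> E 1 3 + (M $ 2 $ 3 \<cdot> E 2 3 + M $ 3 $ 3 \<cdot> E 3 3)))"
      using assms[OF that] by (simp add: E_def mat3_eq_iff axis_def)
    moreover have "\<dots> \<in> mats.span ?G"
      by (intro mats.span_add mats.span_scale mats.span_base) auto
    ultimately show ?thesis
      by simp
  qed
  moreover have "\<exists>u v. F = outer u v" if "F \<in> ?G" for F
    using that by (auto simp: E_def)
  ultimately show ?thesis
    by (intro simple_spanI[of ?G]) auto
qed

text \<open>Together with \<open>simple_span_1_adj3\<close> this shows that invertible
  multiplication preserves \<open>adj3 M \<noteq> 0\<close>.\<close>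

lemma simple_span_1_imp_adj3:
  assumes "simple_span 1 {M}"
  shows "adj3 M = 0"
proof -
  obtain G where G: "finite G" "card G \<le> 1" "\<forall>E\<in>G. \<exists>u v. E = outer u v" "M \<in> mats.span G"
    using assms unfolding simple_span_def by auto
  have "\<exists>u v. G \<subseteq> {outer u v}"
  proof (cases "G = {}")
    case False
    then obtain E where "G = {E}"
      using G(1,2) by (metis card_0_eq card_1_singletonE le_antisym less_one not_le)
    then show ?thesis
      using G(3) by blast
  qed auto
  then obtain u v where "M \<in> mats.span {outer u v}"
    using G(4) mats.span_mono by blast
  then obtain c where "M = c \<cdot> outer u v"
    by (auto simp: mats.span_singleton)
  then have "M = outer (c *s u) v"
    by (simp add: vec_eq_iff mult.assoc)
  then show ?thesis
    by (simp add: adj3_outer)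
qed

text \<open>The zeros say that \<open>B\<close> has axis 2 as right and axis 3 as left kernel
  vector, and \<open>C\<close> axis 1 and axis 2. Divisibility of the determinant by
  \<open>z\<^sup>2\<close> forces further zeros, also in \<open>A\<close>.\<close>

lemma simple_span_5_normal_form:
  fixes A B C :: "complex ^ 3 ^ 3"
  assumes det: "\<And>x y z. det (z \<cdot> A + (x \<cdot> B + y \<cdot> C)) = z\<^sup>2 * (\<alpha> * z + \<beta> * x + \<gamma> * y)"
    and B0: "B $ 1 $ 2 = 0" "B $ 2 $ 2 = 0" "B $ 3 $ 1 = 0" "B $ 3 $ 2 = 0" "B $ 3 $ 3 = 0"
    and C0: "C $ 1 $ 1 = 0" "C $ 2 $ 1 = 0" "C $ 3 $ 1 = 0" "C $ 2 $ 2 = 0" "C $ 2 $ 3 = 0"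
    and "adj3 B \<noteq> 0" "adj3 C \<noteq> 0"
  shows "simple_span 5 {A, B, C}"
proof -
  have Bm: "B $ 1 $ 3 * B $ 2 $ 1 - B $ 1 $ 1 * B $ 2 $ 3 \<noteq> 0"
    using \<open>adj3 B \<noteq> 0\<close> B0 by (auto simp: mat3_eq_iff adj3_nth)
  have Cm: "C $ 3 $ 2 * C $ 1 $ 3 - C $ 3 $ 3 * C $ 1 $ 2 \<noteq> 0"
    using \<open>adj3 C \<noteq> 0\<close> C0 by (auto simp: mat3_eq_iff adj3_nth)
  have det0: "det (x \<cdot> B + y \<cdot> C) = 0" for x y
    using det[of 0 x y] by simp
  \<comment> \<open>These are the coefficients of \<open>x\<^sup>2 * y\<close> and
    \<open>x * y\<^sup>2\<close> in \<open>det (x \<cdot> B + y \<cdot> C)\<close>.\<close>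
  have "C $ 3 $ 2 * (B $ 1 $ 3 * B $ 2 $ 1 - B $ 1 $ 1 * B $ 2 $ 3) = 0"
    "B $ 2 $ 1 * (C $ 3 $ 2 * C $ 1 $ 3 - C $ 3 $ 3 * C $ 1 $ 2) = 0"
    using det0[of 1 1] det0[of 1 "-1"] by (simp_all add: det_3 B0 C0) algebra+
  then have z: "C $ 3 $ 2 = 0" "B $ 2 $ 1 = 0"
    using Bm Cm by simp_all
  have nz: "B $ 1 $ 1 \<noteq> 0" "B $ 2 $ 3 \<noteq> 0" "C $ 1 $ 2 \<noteq> 0" "C $ 3 $ 3 \<noteq> 0"
    using Bm Cm z by auto
  \<comment> \<open>This trace is the coefficient of \<open>z\<close> in a polynomial divisible by
    \<open>z\<^sup>2\<close>; the samples \<open>1\<close>, \<open>-1\<close>, \<open>2\<close> for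
    \<open>z\<close> isolate it.\<close>
  have tr: "trace (adj3 (x \<cdot> B + y \<cdot> C) ** A) = 0" for x y
  proof -
    define d e f m where "d = det A" and "e = trace (adj3 A ** (x \<cdot> B + y \<cdot> C))"
      and "f = trace (adj3 (x \<cdot> B + y \<cdot> C) ** A)" and "m = \<beta> * x + \<gamma> * y"
    have *: "z ^ 3 * d + z\<^sup>2 * e + z * f = z\<^sup>2 * (\<alpha> * z + m)" for z
      using det[of z x y] unfolding det_pencil[of z A] det0 d_def e_def f_def m_def by (simp add: add.assoc)
    have "d + e + f = \<alpha> + m" "- d + e - f = - \<alpha> + m" "8 * d + 4 * e + 2 * f = 4 * (2 * \<alpha> + m)"
      using *[of 1] *[of "-1"] *[of 2] by (simp_all add: mult.commute)
    then have "f = 0"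
      by algebra
    then show ?thesis
      by (simp add: f_def)
  qed
  have "A $ 2 $ 1 * (C $ 3 $ 3 * C $ 1 $ 2) = 0"
    using tr[of 0 1] by (auto simp: trace_def sum_3 matrix_matrix_mult_def adj3_nth B0 C0 z)
  moreover have "A $ 3 $ 2 * (B $ 1 $ 1 * B $ 2 $ 3) = 0"
    using tr[of 1 0] by (auto simp: trace_def sum_3 matrix_matrix_mult_def adj3_nth B0 C0 z)
  ultimately have Az: "A $ 2 $ 1 = 0" "A $ 3 $ 2 = 0"
    using nz by simp_all
  \<comment> \<open>The relation makes \<open>A $ 3 $ 1\<close> vanish with
    \<open>A $ 2 $ 2\<close>; in the other case it turns the coefficient of \<open>a * y\<close>
    below into \<open>- k\<close>.\<close>
  have A: "C $ 3 $ 3 * B $ 1 $ 1 * A $ 2 $ 2 + B $ 2 $ 3 * C $ 1 $ 2 * A $ 3 $ 1 = 0"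
    using tr[of 1 1] by (simp add: trace_def sum_3 matrix_matrix_mult_def adj3_nth B0 C0 z Az algebra_simps)
  show ?thesis
  proof (cases "A $ 2 $ 2 = 0")
    case True
    then have "A $ 3 $ 1 = 0"
      using A nz by simp
    then show ?thesis
      using True Az B0 C0 z by (intro simple_span_5_cross) auto
  next
    case False
    define E E' :: "complex ^ 3 ^ 3" where "E = outer (axis 1 1) (B $ 1)" and "E' = outer (axis 2 1) (B $ 2)"
    \<comment> \<open>Perturbing the pencil of \<open>A\<close> and \<open>C\<close> by the two rank-one summands of \<open>B\<close> gives it
      three distinct singular points, one of them at infinity.\<close>
    have B: "B = E + E'"
      by (simp add: mat3_eq_iff E_def E'_def axis_def B0)
    define k where "k = B $ 1 $ 1 * A $ 2 $ 2 * C $ 3 $ 3"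
    have k: "k \<noteq> 0"
      using nz False by (simp add: k_def)
    \<comment> \<open>The linear coefficient in \<open>y\<close> for \<open>a = 0\<close>, read off
      at \<open>y = 1\<close>; the cubic coefficient \<open>det (C + E)\<close> is zero.\<close>
    define p where "p = det (A + (C + E)) - k - det A"
    define r' where "r' = A $ 3 $ 1 * A $ 1 $ 2 * B $ 2 $ 3"
    have k': "B $ 2 $ 3 * C $ 1 $ 2 * A $ 3 $ 1 = - k"
      using A by (simp add: k_def add_eq_0_iff mult_ac)
    have expand: "det ((A + a \<cdot> E') + y \<cdot> (C + E)) = k * y\<^sup>2 + (p - k * a) * y + (det A + r' * a)" for a y
    proof -
      have "det ((A + a \<cdot> E') + y \<cdot> (C + E)) = k * y\<^sup>2 + (p + B $ 2 $ 3 * C $ 1 $ 2 * A $ 3 $ 1 * a) * y + (det A + r' * a)"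
        by (simp add: det_3 E_def E'_def axis_def B0 C0 z Az p_def k_def r'_def algebra_simps power2_eq_square)
      then show ?thesis
        by (simp add: k')
    qed
    \<comment> \<open>The discriminant in \<open>y\<close> is quadratic in \<open>a\<close> with
      leading coefficient \<open>k\<^sup>2\<close>, so it cannot vanish identically.\<close>
    have "\<exists>a. (p - k * a)\<^sup>2 - 4 * k * (det A + r' * a) \<noteq> 0"
    proof (rule ccontr)
      assume "\<not> ?thesis"
      then have *: "(p - k * a)\<^sup>2 - 4 * k * (det A + r' * a) = 0" for a
        by blast
      have "k * k = 0"
        using *[of 0] *[of 1] *[of "-1"] by algebra
      with k show False
        by simp
    qed
    then obtain a where a: "(p - k * a)\<^sup>2 - 4 * k * (det A + r' * a) \<noteq> 0"
      by blast
    obtain y1 y2 where y12: "(p - k * a) / k = - (y1 + y2)" "(det A + r' * a) / k = y1 * y2"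
      using quadratic_factor .
    then have y12': "p - k * a = - k * (y1 + y2)" "det A + r' * a = k * (y1 * y2)"
      using k by (simp_all add: field_simps)
    have "det ((A + a \<cdot> E') + y \<cdot> (C + E)) = k * ((y - y1) * (y - y2))" for y
      unfolding expand y12' by (simp add: power2_eq_square algebra_simps)
    moreover obtain y0 where "y0 \<notin> {y1, y2}"
      using ex_new_if_finite[OF infinite_UNIV_char_0, of "{y1, y2}"] by auto
    moreover have "y1 \<noteq> y2"
      using a unfolding y12' by (auto simp: power2_eq_square algebra_simps)
    moreover have "det (C + E) = 0"
      by (simp add: det_3 E_def axis_def B0 C0 z)
    ultimately have "simple_span 3 {A + a \<cdot> E', C + E}"
      using k by (intro simple_span_3_singular_points[of _ _ y1 y2 y0]) simp_all
    then have "simple_span (3 + (1 + 1)) ({A + a \<cdot> E', C + E} \<union> ({E} \<union> {E'}))"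
      unfolding E_def E'_def by (intro simple_span_Un simple_span_1_outer)
    then have "simple_span 5 {A + a \<cdot> E', C + E, E, E'}"
      by (simp add: insert_commute)
    then show ?thesis
    proof (rule simple_span_subset_span)
      let ?S = "mats.span {A + a \<cdot> E', C + E, E, E'}"
      have span: "A + a \<cdot> E' \<in> ?S" "C + E \<in> ?S" "E \<in> ?S" "E' \<in> ?S"
        by (simp_all add: mats.span_base)
      have "A \<in> ?S" "C \<in> ?S" "B \<in> ?S"
        using mats.span_diff[OF span(1) mats.span_scale[OF span(4), of a]]
          mats.span_diff[OF span(2,3)] mats.span_add[OF span(3,4)] B by simp_all
      then show "{A, B, C} \<subseteq> ?S"
        by simp
    qed
  qed
qed

text \<open>If neither adjugate vanishes, the singular \<open>B\<close> and \<open>C\<close> have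
  kernel vectors on both sides. Proportional ones yield a common kernel vector; otherwise they
  extend to bases that produce the sparse form.\<close>

lemma simple_span_5_double_line:
  fixes A B C :: "complex ^ 3 ^ 3"
  assumes det: "\<And>x y z. det (z \<cdot> A + (x \<cdot> B + y \<cdot> C)) = z\<^sup>2 * (\<alpha> * z + \<beta> * x + \<gamma> * y)"
  shows "simple_span 5 {A, B, C}"
proof (cases "adj3 B = 0 \<or> adj3 C = 0")
  case True
  then show ?thesis
    using simple_span_5_singular_outer[of 1 B 0 A 0 C] simple_span_5_singular_outer[of 1 C 0 A 0 B]
    by (auto simp: insert_commute)
next
  case False
  have "det B = 0" "det C = 0"
    using det[of 0 1 0] det[of 0 0 1] by simp_all
  with False obtain p q r s where p: "p \<noteq> 0" "B *v p = 0" and q: "q \<noteq> 0" "q v* B = 0"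
    and r: "r \<noteq> 0" "C *v r = 0" and s: "s \<noteq> 0" "s v* C = 0"
    using kernel_vectors by metis
  show ?thesis
  proof (cases "(\<exists>c. r = c *s p) \<or> (\<exists>c. s = c *s q)")
    case True
    then show ?thesis
    proof
      assume "\<exists>c. r = c *s p"
      then have "B *v r = 0"
        using p by (auto simp: vec.scale)
      then show ?thesis
        using r by (intro simple_span_5_right_kernel)
    next
      assume "\<exists>c. s = c *s q"
      then have "s v* B = 0"
        using q by (auto simp: vector_matrix_mult_def vec_eq_iff sum_distrib_left[symmetric] mult.assoc mult.left_commute)
      then show ?thesis
        using s by (intro simple_span_5_left_kernel)
    qed
  next
    case nonpar: False
    obtain e where e: "det (vector [e, s, q] :: complex ^ 3 ^ 3) \<noteq> 0"
      using nonpar q(1) det_rows_completion by blast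
    obtain f where f: "det (vector [f, r, p] :: complex ^ 3 ^ 3) \<noteq> 0"
      using nonpar p(1) det_rows_completion by blast
    \<comment> \<open>The order of rows in \<open>P\<close> and columns in \<open>Q\<close> makes
      row 3 and column 2 of the transformed \<open>B\<close>, and row 2 and column 1 of the
      transformed \<open>C\<close>, vanish.\<close>
    define P :: "complex ^ 3 ^ 3" where "P = vector [e, s, q]"
    define Q :: "complex ^ 3 ^ 3" where "Q = (\<chi> i. vector [r $ i, p $ i, f $ i])"
    have detP: "det P \<noteq> 0"
      using e by (simp add: P_def)
    have "det Q = det (vector [f, r, p] :: complex ^ 3 ^ 3)"
      by (simp add: Q_def det_3 algebra_simps)
    with f have detQ: "det Q \<noteq> 0"
      by simp
    have inv: "invertible P" "invertible Q"
      using detP detQ by (simp_all add: invertible_det_nz)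
    define F where "F M = P ** M ** Q" for M
    have row: "F M $ i = (P $ i v* M) v* Q" for M i
      by (simp add: F_def vec_eq_iff matrix_matrix_mult_def vector_matrix_mult_def mult_ac)
    have col: "F M $ i $ j = (P *v (M *v column j Q)) $ i" for M i j
      by (simp add: F_def matrix_matrix_mult_def matrix_vector_mult_def column_def sum_3 algebra_simps)
    have cols: "column 1 Q = r" "column 2 Q = p"
      by (simp_all add: column_def Q_def vec_eq_iff)
    have rows: "P $ 2 = s" "P $ 3 = q"
      by (simp_all add: P_def)
    have adj: "adj3 (F M) \<noteq> 0" if "adj3 M \<noteq> 0" for M
    proof
      assume "adj3 (F M) = 0"
      then have "simple_span 1 {F M}"
        by (rule simple_span_1_adj3)
      then have "simple_span 1 {M}"
        using simple_span_mult_iff[OF inv, of 1 "{M}"] by (simp add: F_def)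
      then show False
        using that simple_span_1_imp_adj3 by blast
    qed
    have "simple_span 5 {F A, F B, F C}"
    proof (rule simple_span_5_normal_form)
      show "det (z \<cdot> F A + (x \<cdot> F B + y \<cdot> F C)) =
        z\<^sup>2 * ((det P * \<alpha> * det Q) * z + (det P * \<beta> * det Q) * x + (det P * \<gamma> * det Q) * y)" for x y z
      proof -
        have "z \<cdot> F A + (x \<cdot> F B + y \<cdot> F C) = F (z \<cdot> A + (x \<cdot> B + y \<cdot> C))"
          by (simp add: F_def mat3_eq_iff matrix_matrix_mult_def sum_3 algebra_simps)
        then have "det (z \<cdot> F A + (x \<cdot> F B + y \<cdot> F C)) = det P * det (z \<cdot> A + (x \<cdot> B + y \<cdot> C)) * det Q"
          by (simp add: F_def det_mul)
        then show ?thesis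
          unfolding det by (simp add: algebra_simps)
      qed
    next
      have "F B $ i $ 2 = 0" "F C $ i $ 1 = 0" for i
        by (simp_all add: col cols p r)
      moreover have "F B $ 3 = 0" "F C $ 2 = 0"
        by (simp_all add: row rows q s)
      ultimately show "F B $ 1 $ 2 = 0" "F B $ 2 $ 2 = 0" "F B $ 3 $ 1 = 0" "F B $ 3 $ 2 = 0" "F B $ 3 $ 3 = 0"
        "F C $ 1 $ 1 = 0" "F C $ 2 $ 1 = 0" "F C $ 3 $ 1 = 0" "F C $ 2 $ 2 = 0" "F C $ 2 $ 3 = 0"
        by simp_all
    qed (use False adj in auto)
    then show ?thesis
      using simple_span_mult_iff[OF inv, of 5 "{A, B, C}"] by (simp add: F_def)
  qed
qed

subsection \<open>Nonsingular triples\<close>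

lemma cubic_double_root:
  assumes "disc3 a b c = 0"
  obtains r s where "a = - (2 * r + s)" "b = r\<^sup>2 + 2 * r * s" "c = - (r\<^sup>2 * s)"
proof -
  obtain r s t where rst: "a = - (r + s + t)" "b = r * s + s * t + t * r" "c = - (r * s * t)"
    using cubic_factor .
  have "r = s \<or> s = t \<or> t = r"
    using assms unfolding rst disc3_roots by auto
  then show ?thesis
    using that[of r t] that[of s r] that[of t s] rst
    by (auto simp: power2_eq_square algebra_simps)
qed

text \<open>For \<open>x = 1\<close> the discriminant is a polynomial in \<open>y\<close>. Its
  extreme coefficients give \<open>\<tau> = 0 \<or> k = 0\<close> and
  \<open>\<sigma> = 0 \<or> l = 0\<close>, whence \<open>c2\<close> and \<open>c4\<close> kill
  \<open>k\<close> and \<open>l\<close>. What remains is \<open>\<tau>\<^sup>2 * h\<^sup>2\<close>,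
  \<open>2 * \<tau> * \<sigma> * h\<^sup>2 - 4 * h ^ 3\<close> and
  \<open>\<sigma>\<^sup>2 * h\<^sup>2\<close>, which forces \<open>h = 0\<close>.\<close>

lemma disc3_0_binary:
  assumes "\<And>x y. disc3 (\<tau> * x + \<sigma> * y) (h * x * y) (x * y * (k * x + l * y)) = 0"
  shows "h = 0 \<and> k = 0 \<and> l = 0"
proof -
  define c2 where "c2 = \<tau>\<^sup>2 * h\<^sup>2 - 4 * (\<tau> ^ 3 * l + 3 * \<tau>\<^sup>2 * \<sigma> * k) - 27 * k\<^sup>2 + 18 * \<tau> * h * k"
  define c3 where "c3 = 2 * \<tau> * \<sigma> * h\<^sup>2 - 4 * h ^ 3 - 12 * \<tau> * \<sigma> * (\<tau> * l + \<sigma> * k) - 54 * k * l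
    + 18 * h * (\<tau> * l + \<sigma> * k)"
  define c4 where "c4 = \<sigma>\<^sup>2 * h\<^sup>2 - 4 * (\<sigma> ^ 3 * k + 3 * \<tau> * \<sigma>\<^sup>2 * l) - 27 * l\<^sup>2 + 18 * \<sigma> * h * l"
  have "poly [:0, - 4 * \<tau> ^ 3 * k, c2, c3, c4, - 4 * \<sigma> ^ 3 * l:] y = 0" for y
    using assms[of 1 y]
    by (simp add: disc3_def c2_def c3_def c4_def power2_eq_square power3_eq_cube algebra_simps)
  then have "[:0, - 4 * \<tau> ^ 3 * k, c2, c3, c4, - 4 * \<sigma> ^ 3 * l:] = 0"
    using poly_all_0_iff_0 by blast
  then have c: "\<tau> = 0 \<or> k = 0" "c2 = 0" "c3 = 0" "c4 = 0" "\<sigma> = 0 \<or> l = 0"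
    by simp_all
  have k: "k = 0"
    using c(1,2) by (auto simp: c2_def)
  have l: "l = 0"
    using c(4,5) by (auto simp: c4_def)
  have "h = 0"
    using c(2-4) by (auto simp: k l c2_def c3_def c4_def)
  with k l show ?thesis
    by simp
qed

text \<open>A pencil through \<open>mat 1\<close> with three distinct singular points costs three matrices of rank
  one, and a singular matrix outside it costs two more.\<close>

lemma simple_span_5_generic:
  assumes "disc3 (trace M) (trace (adj3 M)) (det M) \<noteq> 0" "M = c \<cdot> mat 1 + (x \<cdot> B + y \<cdot> C)" "x \<noteq> 0"
  shows "simple_span 5 {mat 1, B, C}"
proof -
  obtain r s t where C: "trace C = - (r + s + t)" "trace (adj3 C) = r * s + s * t + t * r" "det C = - (r * s * t)"
    using cubic_factor .
  have "det (r \<cdot> mat 1 + C) = 0"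
    unfolding det_shift C by (simp add: power2_eq_square power3_eq_cube algebra_simps)
  then have "simple_span (3 + 2) ({mat 1, M} \<union> {r \<cdot> mat 1 + C})"
    using assms(1) by (intro simple_span_Un simple_span_3_disc3 simple_span_2_singular)
  then have "simple_span 5 {mat 1, M, r \<cdot> mat 1 + C}"
    by (simp add: insert_commute)
  then have "simple_span 5 {x \<cdot> B + y \<cdot> C + c \<cdot> mat 1, C, mat 1}"
  proof (rule simple_span_subset_span)
    have "C = (- r) \<cdot> mat 1 + 0 \<cdot> M + 1 \<cdot> (r \<cdot> mat 1 + C)"
      by (simp add: vec_eq_iff)
    from in_span3[OF this] show "{x \<cdot> B + y \<cdot> C + c \<cdot> mat 1, C, mat 1} \<subseteq> mats.span {mat 1, M, r \<cdot> mat 1 + C}"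
      by (simp add: assms(2) mats.span_base add_ac)
  qed
  then have "simple_span 5 {B, C, mat 1}"
    using assms(3) by (rule simple_span_replace)
  then show ?thesis
    by (simp add: insert_commute)
qed

lemma trace_lincomb: "trace (x \<cdot> B + y \<cdot> C :: complex ^ 3 ^ 3) = trace B * x + trace C * y"
  by (simp add: trace_def sum_3 algebra_simps)

lemma trace_adj3_lincomb:
  "trace (adj3 (x \<cdot> B + y \<cdot> C)) =
    x\<^sup>2 * trace (adj3 B) + (trace B * trace C - trace (B ** C)) * x * y + y\<^sup>2 * trace (adj3 C)"
  by (simp add: trace_def sum_3 matrix_matrix_mult_def adj3_nth power2_eq_square algebra_simps)

lemma det_lincomb:
  "det (x \<cdot> B + y \<cdot> C) = x ^ 3 * det B + x * y * (trace (adj3 B ** C) * x + trace (adj3 C ** B) * y) + y ^ 3 * det C"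
  by (simp add: adj3_nth det_3 matrix_matrix_mult_def sum_3 trace_def power3_eq_cube algebra_simps)

lemma simple_span_5_mat_1: "simple_span 5 {mat 1, B, C :: complex ^ 3 ^ 3}"
proof (cases "\<exists>c x y. let M = c \<cdot> mat 1 + (x \<cdot> B + y \<cdot> C) in disc3 (trace M) (trace (adj3 M)) (det M) \<noteq> 0")
  case True
  then obtain c x y M where M: "M = c \<cdot> mat 1 + (x \<cdot> B + y \<cdot> C)" "disc3 (trace M) (trace (adj3 M)) (det M) \<noteq> 0"
    by (auto simp: Let_def)
  \<comment> \<open>Otherwise \<open>M\<close> is a scalar matrix, with a triple zero. A nonzero
    coefficient lets \<open>M\<close> replace \<open>B\<close> or \<open>C\<close>.\<close>
  have "x \<noteq> 0 \<or> y \<noteq> 0"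
  proof (rule ccontr)
    assume "\<not> ?thesis"
    then have "disc3 (trace M) (trace (adj3 M)) (det M) = 0"
      unfolding M(1) trace_shift trace_adj3_shift det_shift
      by (simp add: disc3_def trace_def sum_3 adj3_nth det_3 power2_eq_square power3_eq_cube algebra_simps)
    with M(2) show False ..
  qed
  then show ?thesis
    using simple_span_5_generic[OF M(2), of c x B y C] simple_span_5_generic[OF M(2), of c y C x B] M(1)
    by (auto simp: insert_commute add.commute)
next
  case False
  then have disc: "disc3 (trace M) (trace (adj3 M)) (det M) = 0" if "M = c \<cdot> mat 1 + (x \<cdot> B + y \<cdot> C)" for M c x y
    using that by (auto simp: Let_def)
  have shift: "\<exists>r. trace (adj3 (r \<cdot> mat 1 + M)) = 0 \<and> det (r \<cdot> mat 1 + M) = 0"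
    if zero: "disc3 (trace M) (trace (adj3 M)) (det M) = 0" for M
  proof -
    obtain r s where rs: "trace M = - (2 * r + s)" "trace (adj3 M) = r\<^sup>2 + 2 * r * s" "det M = - (r\<^sup>2 * s)"
      using cubic_double_root[OF zero] .
    have "trace (adj3 (r \<cdot> mat 1 + M)) = 0 \<and> det (r \<cdot> mat 1 + M) = 0"
      unfolding trace_adj3_shift det_shift rs by (simp add: power2_eq_square power3_eq_cube algebra_simps)
    then show ?thesis ..
  qed
  have "B = 0 \<cdot> mat 1 + (1 \<cdot> B + 0 \<cdot> C)" "C = 0 \<cdot> mat 1 + (0 \<cdot> B + 1 \<cdot> C)"
    by simp_all
  from this[THEN disc, THEN shift] obtain r s where
    r: "trace (adj3 (r \<cdot> mat 1 + B)) = 0" "det (r \<cdot> mat 1 + B) = 0" and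
    s: "trace (adj3 (s \<cdot> mat 1 + C)) = 0" "det (s \<cdot> mat 1 + C) = 0"
    by blast
  \<comment> \<open>Zero becomes a double root of the characteristic polynomials of both matrices.\<close>
  define B' C' where "B' = r \<cdot> mat 1 + B" and "C' = s \<cdot> mat 1 + C"
  \<comment> \<open>With the pure terms gone, these mixed coefficients of the quadratic and cubic
    invariants are all that survives; they too will vanish.\<close>
  define h k l where "h = trace B' * trace C' - trace (B' ** C')"
    and "k = trace (adj3 B' ** C')" and "l = trace (adj3 C' ** B')"
  have e2: "trace (adj3 (x \<cdot> B' + y \<cdot> C')) = h * x * y"
    and e3: "det (x \<cdot> B' + y \<cdot> C') = x * y * (k * x + l * y)" for x y
    unfolding trace_adj3_lincomb det_lincomb h_def k_def l_def
    using r s by (simp_all add: B'_def C'_def)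
  \<comment> \<open>Combinations of \<open>B'\<close> and \<open>C'\<close> are combinations of
    \<open>mat 1\<close>, \<open>B\<close> and \<open>C\<close>, so their discriminants vanish as
    well.\<close>
  have "disc3 (trace B' * x + trace C' * y) (h * x * y) (x * y * (k * x + l * y)) = 0" for x y
  proof -
    have "x \<cdot> B' + y \<cdot> C' = (x * r + y * s) \<cdot> mat 1 + (x \<cdot> B + y \<cdot> C)"
      by (simp add: B'_def C'_def vec_eq_iff algebra_simps)
    from disc[OF this] show ?thesis
      unfolding e2 e3 trace_lincomb .
  qed
  then have "h = 0 \<and> k = 0 \<and> l = 0"
    by (rule disc3_0_binary)
  then have "det (z \<cdot> mat 1 + (x \<cdot> B' + y \<cdot> C')) = z\<^sup>2 * (1 * z + trace B' * x + trace C' * y)" for x y z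
    unfolding det_shift e2 e3 trace_lincomb by (simp add: power2_eq_square power3_eq_cube algebra_simps)
  then have "simple_span 5 {mat 1, B', C'}"
    by (rule simple_span_5_double_line)
  then show ?thesis
  proof (rule simple_span_subset_span)
    have "B = (- r) \<cdot> mat 1 + 1 \<cdot> B' + 0 \<cdot> C'" "C = (- s) \<cdot> mat 1 + 0 \<cdot> B' + 1 \<cdot> C'"
      by (simp_all add: B'_def C'_def vec_eq_iff)
    from this[THEN in_span3] show "{mat 1, B, C} \<subseteq> mats.span {mat 1, B', C'}"
      by (simp add: mats.span_base)
  qed
qed

lemma simple_span_5_nonsingular:
  fixes A B C :: "complex ^ 3 ^ 3"
  assumes "det (x \<cdot> A + y \<cdot> B + z \<cdot> C) \<noteq> 0" "x \<noteq> 0"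
  shows "simple_span 5 {A, B, C}"
proof (rule simple_span_replace[OF _ assms(2)])
  let ?K = "x \<cdot> A + y \<cdot> B + z \<cdot> C"
  obtain K' where "K' ** ?K = mat 1"
    using assms(1) invertible_det_nz[of ?K] invertible_left_inverse[of ?K] by blast
  then show "simple_span 5 {?K, B, C}"
    by (simp add: simple_span_insert_mat_1 simple_span_5_mat_1)
qed

text \<open>An identically zero cubic form counts as a double line with zero cofactor; otherwise a
  nonsingular combination replaces one of the matrices and is moved to \<open>mat 1\<close>.\<close>

lemma simple_span_5_triple: "simple_span 5 {A, B, C :: complex ^ 3 ^ 3}"
proof (cases "\<forall>x y z. det (x \<cdot> A + y \<cdot> B + z \<cdot> C) = 0")
  case True
  then have "det (z \<cdot> A + (x \<cdot> B + y \<cdot> C)) = z\<^sup>2 * (0 * z + 0 * x + 0 * y)" for x y z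
    by (simp add: add.assoc)
  then show ?thesis
    by (rule simple_span_5_double_line)
next
  case False
  then obtain x y z where d: "det (x \<cdot> A + y \<cdot> B + z \<cdot> C) \<noteq> 0"
    by blast
  then have "x \<noteq> 0 \<or> y \<noteq> 0 \<or> z \<noteq> 0"
    by (auto simp: det_3)
  then show ?thesis
    using simple_span_5_nonsingular[of x A y B z C] simple_span_5_nonsingular[of y B x A z C]
      simple_span_5_nonsingular[of z C x A y B] d
    by (auto simp: insert_commute ac_simps)
qed

subsection \<open>The rank bound\<close>

text \<open>The given outer products may be zero and so not simple; the induction drops such
  summands, leaving some \<open>m \<le> n\<close> simple tensors.\<close>

lemma tensor_rank_le:
  fixes T :: "complex ^ 'r ^ 'q ^ 'p"
  assumes "T = (\<Sum>s=1..n. outer3 (a s) (b s) (c s))"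
  shows "tensor_rank T \<le> n"
proof -
  have "\<exists>m\<le>n. sum_of_simple_tensors m (\<Sum>s=1..n. outer3 (a s) (b s) (c s))"
  proof (induction n)
    case 0
    then show ?case
      by (simp add: sum_of_simple_tensors_def)
  next
    case (Suc n)
    let ?X = "outer3 (a (Suc n)) (b (Suc n)) (c (Suc n))"
    obtain m S where m: "m \<le> n" "\<forall>s\<in>{1..m}. simple_tensor (S s)"
      "(\<Sum>s=1..n. outer3 (a s) (b s) (c s)) = (\<Sum>s=1..m. S s)"
      using Suc.IH unfolding sum_of_simple_tensors_def by blast
    show ?case
    proof (cases "simple_tensor ?X")
      case True
      define S' where "S' = S(Suc m := ?X)"
      have "\<forall>s\<in>{1..Suc m}. simple_tensor (S' s)"
        using m(2) True by (auto simp: S'_def le_Suc_eq)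
      moreover have "(\<Sum>s=1..m. S' s) = (\<Sum>s=1..m. S s)"
        by (intro sum.cong) (auto simp: S'_def)
      then have "(\<Sum>s=1..Suc n. outer3 (a s) (b s) (c s)) = (\<Sum>s=1..Suc m. S' s)"
        using m(3) by (simp add: S'_def)
      ultimately show ?thesis
        using m(1) unfolding sum_of_simple_tensors_def by (intro exI[of _ "Suc m"]) blast
    next
      case False
      then have "a (Suc n) = 0 \<or> b (Suc n) = 0 \<or> c (Suc n) = 0"
        by (auto simp: simple_tensor_def)
      then have "?X = 0"
        by (auto simp: outer3_def vec_eq_iff)
      then show ?thesis
        using Suc.IH by (auto simp: le_Suc_eq)
    qed
  qed
  then obtain m where "m \<le> n" "sum_of_simple_tensors m T"
    using assms by blast
  then show ?thesis
    unfolding tensor_rank_def by (meson Least_le le_trans)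
qed

theorem theorem4p1:
  fixes T :: "complex ^ 3 ^ 3 ^ 3"
  shows "tensor_rank T \<le> 5 \<and>
    (\<exists>n \<le> 5. \<exists>a b c :: nat \<Rightarrow> complex ^ 3. T = (\<Sum>s=1..n. outer3 (a s) (b s) (c s)))"
proof -
  have "range (($) T) = {T $ 1, T $ 2, T $ 3}"
    by (simp add: UNIV_3)
  then have "simple_span 5 (range (($) T))"
    using simple_span_5_triple by simp
  then obtain a b c where T: "T = (\<Sum>s=1..(5::nat). outer3 (a s) (b s) (c s))"
    using simple_span_iff_tensor by blast
  show ?thesis
    using tensor_rank_le[OF T] T by blast
qed

end
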